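(* Fix a tree partition of $\omega$ with its derived ideals $\mathcal H_\alpha$ $(\alpha<\omega_1)$, and put $\mathcal H_{<\omega}:=\bigcup_{n<\omega}\mathcal H_n$. Then $\mathcal H_{<\omega}=\mathcal H_\omega$; it is a tall ideal of class $\boldsymbol\Sigma^0_\omega$ and of separation rank exactly $\omega$; it is strictly above every $\mathcal H_n$ $(n<\omega)$ both in $\le_K$ and in $\le_{KB}$ (that is, $\mathcal H_n\le_{KB}\mathcal H_{<\omega}$, hence $\mathcal H_n\leq_K\mathcal H_{<\omega}$, while $\mathcal H_{<\omega}\not\le_K\mathcal H_n$, hence $\mathcal H_{<\omega}\not\leq_{KB}\mathcal H_n$); and $\mathrm{Fin}'_\omega\sqsubseteq\mathcal H_{<\omega}$.
   Context: All ideals are proper and contain all finite sets. A tree partition of $\omega$ is a family $\langle A_s:s\in\omega^{<\omega}\rangle$ of infinite subsets of $\omega$ such that $A_\varnothing=\omega$, for each $s$ the family $\{A_{s^\frown n}:n\in\omega\}$ is a partition of $A_s$, and any two distinct points of $\omega$ lie in different cells $A_s\neq A_t$ with $|s|=|t|=n$ for some $n$. For $X\subseteq\omega$ let $T^\infty_X=\{s\in\omega^{<\omega}:X\cap A_s\text{ is infinite}\}$. For $T\subseteq\omega^{<\omega}$ put $\mathrm{Succ}_T(s)=\{n:s^\frown n\in T\}$ and $D(T)=\{s\in T:\mathrm{Succ}_T(s)\text{ is infinite}\}$; $D^0(T)=T$, $D^{\alpha+1}(T)=D(D^\alpha(T))$, $D^\lambda(T)=\bigcap_{\beta<\lambda}D^\beta(T)$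 for limit $\lambda$. For $\alpha<\omega_1$, $\mathcal H_\alpha=\{X\subseteq\omega:\varnothing\notin D^\alpha(T^\infty_X)\}$. An ideal on $\omega$ is tall if every infinite subset of $\omega$ contains an infinite member of the ideal. $\mathcal I\le_K\mathcal J$ means there is $f:\operatorname{dom}(\mathcal J)\to\operatorname{dom}(\mathcal I)$ with $f^{-1}[A]\in\mathcal J$ for all $A\in\mathcal I$; $\le_{KB}$ requires $f$ finite-to-one; $\mathcal I\sqsubseteq\mathcal J$ requires $f$ bijective. Separation rank (Debs–Saint Raymond): $\mathrm{rk}(\mathcal I)$ is the least ordinal $\alpha$ such that some $\boldsymbol\Sigma^0_{1+\alpha}$ subset of $\mathcal P(\operatorname{dom}\mathcal I)$ contains $\mathcal I$ and is disjoint from the dual filter of $\mathcal I$. Known facts: $\mathrm{rk}$ is monotone under $\sqsubseteq$ and $\mathrm{rk}(\mathrm{Fin}^{\otimes r})=r$, and each $\mathrm{Fin}^{\otimes r}$ has the property that $\mathrm{Fin}^{\otimes r}\le_K\mathcal J$ implies $\mathrm{Fin}^{\otimes r}\sqsubseteq\mathcal J$. Here $\mathrm{Fin}^{\otimes1}=\mathrm{Fin}$ is the ideal of finite subsets of $\omega$, and $C\in\mathrm{Fin}^{\otimes(k+1)}$ (on $\omega^{k+1}$) iff all but finitely many sections $\{t:(n)^\frown t\in C\}$ are in $\mathrm{Fin}^{\otimes k}$. $\mathrm{Fin}'_\omega$ is Kwela's ideal (the independent-partitions limit of the finite Fubini powers), an ideal on a countable set of rank $\omega$ such that for every ideal $\mathcal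 I$ on a countable set, $\mathrm{Fin}'_\omega\le_K\mathcal I$ iff $\mathrm{Fin}^{\otimes r}\le_K\mathcal I$ for all $r\ge1$, and likewise with $\le_K$ replaced by $\sqsubseteq$ on both sides. *)

theory Defs
  imports "HOL-Analysis.Analysis"
begin

section \<open>Countable ordinals\<close>

text \<open>The type of all ordinals below \<open>\<omega>\<^sub>1\<close>: the field of the well-order \<open>cardSuc natLeq\<close>, the least
  uncountable well-order.\<close>

typedef countable_ordinal = "Field (cardSuc natLeq)"
proof -
  have "Field (cardSuc natLeq) \<noteq> {}"
    using cardSuc_finite[OF natLeq_Card_order] by (auto simp: Field_natLeq)
  then show ?thesis by blast
qed

lemma Well_order_cardSuc_natLeq: "Well_order (cardSuc natLeq)"
  using cardSuc_Card_order[OF natLeq_Card_order] card_order_on_well_order_on by blast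

instantiation countable_ordinal :: wellorder
begin

definition less_eq_countable_ordinal :: "countable_ordinal \<Rightarrow> countable_ordinal \<Rightarrow> bool" where
  "\<alpha> \<le> \<beta> \<longleftrightarrow> (Rep_countable_ordinal \<alpha>, Rep_countable_ordinal \<beta>) \<in> cardSuc natLeq"

definition less_countable_ordinal :: "countable_ordinal \<Rightarrow> countable_ordinal \<Rightarrow> bool" where
  "\<alpha> < \<beta> \<longleftrightarrow> \<alpha> \<le> \<beta> \<and> \<not> \<beta> \<le> (\<alpha> :: countable_ordinal)"

instance
proof
  note wo = Well_order_cardSuc_natLeq
  have lin: "Linear_order (cardSuc natLeq)"
    using wo by (simp add: well_order_on_def)
  have refl: "Refl (cardSuc natLeq)" and trans: "trans (cardSuc natLeq)"
    and antisym: "antisym (cardSuc natLeq)" and total: "Total (cardSuc natLeq)"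
    using lin by (auto simp: linear_order_on_def partial_order_on_def preorder_on_def)
  have wf: "wf (cardSuc natLeq - Id)"
    using wo by (simp add: well_order_on_def)
  fix \<alpha> \<beta> \<gamma> :: countable_ordinal
  show "\<alpha> < \<beta> \<longleftrightarrow> \<alpha> \<le> \<beta> \<and> \<not> \<beta> \<le> \<alpha>"
    by (rule less_countable_ordinal_def)
  show "\<alpha> \<le> \<alpha>"
    using refl Rep_countable_ordinal[of \<alpha>]
    by (auto simp: less_eq_countable_ordinal_def refl_on_def)
  show "\<alpha> \<le> \<gamma>" if "\<alpha> \<le> \<beta>" "\<beta> \<le> \<gamma>"
    using trans that by (auto simp: less_eq_countable_ordinal_def dest: transD)
  show anti: "\<alpha> = \<beta>" if "\<alpha> \<le> \<beta>" "\<beta> \<le> \<alpha>" for \<alpha> \<beta> :: countable_ordinal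
    using antisym that
    by (auto simp: less_eq_countable_ordinal_def Rep_countable_ordinal_inject dest: antisymD)
  show "\<alpha> \<le> \<beta> \<or> \<beta> \<le> \<alpha>"
    using total Rep_countable_ordinal[of \<alpha>] Rep_countable_ordinal[of \<beta>] \<open>\<alpha> \<le> \<alpha>\<close>
    by (cases "\<alpha> = \<beta>")
      (auto simp: less_eq_countable_ordinal_def total_on_def Rep_countable_ordinal_inject)
  fix P :: "countable_ordinal \<Rightarrow> bool" and a :: countable_ordinal
  assume step: "\<And>x. (\<And>y. y < x \<Longrightarrow> P y) \<Longrightarrow> P x"
  have "wf (inv_image (cardSuc natLeq - Id) Rep_countable_ordinal)"
    using wf by (rule wf_inv_image)
  then show "P a"
  proof (induction a rule: wf_induct_rule)
    case (less x)
    show ?case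
    proof (rule step)
      fix y assume "y < x"
      then have "(y, x) \<in> inv_image (cardSuc natLeq - Id) Rep_countable_ordinal"
        by (auto simp: less_countable_ordinal_def less_eq_countable_ordinal_def)
      then show "P y" by (rule less.IH)
    qed
  qed
qed

end

lemma uncountable_UNIV_countable_ordinal:
  includes cardinal_syntax
  shows "uncountable (UNIV :: countable_ordinal set)"
proof
  assume "countable (UNIV :: countable_ordinal set)"
  then have "countable (Rep_countable_ordinal ` UNIV)" by (rule countable_image)
  then have "countable (Field (cardSuc natLeq))"
    by (simp add: type_definition.Rep_range[OF type_definition_countable_ordinal])
  then have "|Field (cardSuc natLeq)| \<le>o |UNIV :: nat set|"
    by (auto simp: countable_def card_of_ordLeq[symmetric])
  then have "cardSuc natLeq \<le>o natLeq"
    by (metis Card_order_iff_ordLeq_card_of Field_natLeq card_of_Field_ordIso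
        cardSuc_Card_order natLeq_Card_order ordIso_iff_ordLeq ordLeq_transitive)
  then show False
    using cardSuc_greater[OF natLeq_Card_order] not_ordLess_ordLeq by blast
qed

lemma countable_lessThan_countable_ordinal:
  includes cardinal_syntax
  shows "countable {..< \<alpha> :: countable_ordinal}"
proof -
  let ?a = "Rep_countable_ordinal \<alpha>"
  have "|underS (cardSuc natLeq) ?a| <o cardSuc natLeq"
    using card_of_underS[OF cardSuc_Card_order[OF natLeq_Card_order] Rep_countable_ordinal] .
  then have "|underS (cardSuc natLeq) ?a| \<le>o natLeq"
    using cardSuc_ordLeq_ordLess[OF natLeq_Card_order card_of_Card_order] by blast
  then have "|underS (cardSuc natLeq) ?a| \<le>o |UNIV :: nat set|"
    using card_of_nat ordIso_iff_ordLeq ordLeq_transitive by blast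
  then have "countable (underS (cardSuc natLeq) ?a)"
    by (auto simp: countable_def card_of_ordLeq[symmetric])
  moreover have "Rep_countable_ordinal ` {..<\<alpha>} \<subseteq> underS (cardSuc natLeq) ?a"
    by (auto simp: underS_def less_le less_eq_countable_ordinal_def Rep_countable_ordinal_inject)
  ultimately have "countable (Rep_countable_ordinal ` {..<\<alpha>})"
    by (rule countable_subset[rotated])
  then show ?thesis
    by (rule countable_image_inj_on) (auto simp: inj_on_def Rep_countable_ordinal_inject)
qed

lemma countable_ordinal_bounded:
  fixes S :: "countable_ordinal set"
  assumes "countable S"
  shows "\<exists>\<beta>. \<forall>\<alpha>\<in>S. \<alpha> < \<beta>"
proof (rule ccontr)
  assume "\<not> ?thesis"
  then have "\<forall>\<beta>. \<exists>\<alpha>\<in>S. \<beta> \<le> \<alpha>" by (simp add: not_less)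
  then have "(UNIV :: countable_ordinal set) = (\<Union>\<alpha>\<in>S. insert \<alpha> {..<\<alpha>})"
    by (auto simp: le_less)
  moreover have "countable (\<Union>\<alpha>\<in>S. insert \<alpha> {..<\<alpha>})"
    using assms countable_lessThan_countable_ordinal by auto
  ultimately show False using uncountable_UNIV_countable_ordinal by simp
qed

definition osucc :: "countable_ordinal \<Rightarrow> countable_ordinal" where
  "osucc \<alpha> = (LEAST \<beta>. \<alpha> < \<beta>)"

lemma less_osucc: "\<alpha> < osucc \<alpha>"
  unfolding osucc_def using countable_ordinal_bounded[of "{\<alpha>}"] by (auto intro: LeastI_ex)

lemma less_osucc_iff: "\<beta> < osucc \<alpha> \<longleftrightarrow> \<beta> \<le> \<alpha>"
  by (metis Least_le less_osucc le_less_trans not_le osucc_def)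

lemma osucc_inject: "osucc \<alpha> = osucc \<beta> \<longleftrightarrow> \<alpha> = \<beta>"
  by (metis less_osucc less_osucc_iff antisym)

instantiation countable_ordinal :: "{zero, one}"
begin
definition zero_countable_ordinal :: countable_ordinal where "zero_countable_ordinal = (LEAST \<alpha>. True)"
definition one_countable_ordinal :: countable_ordinal where "one_countable_ordinal = osucc 0"
instance ..
end

lemma zero_le_countable_ordinal: "0 \<le> (\<alpha> :: countable_ordinal)"
  unfolding zero_countable_ordinal_def by (rule Least_le) simp

text \<open>The finite ordinals and \<open>\<omega>\<close>.\<close>

definition ord_of_nat :: "nat \<Rightarrow> countable_ordinal" where
  "ord_of_nat n = (osucc ^^ n) 0"

definition omega :: countable_ordinal where
  "omega = (LEAST \<alpha>. \<forall>n. ord_of_nat n < \<alpha>)"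

lemma ord_of_nat_less_omega: "ord_of_nat n < omega"
proof -
  have "\<forall>n. ord_of_nat n < omega"
    unfolding omega_def
    by (rule LeastI_ex) (use countable_ordinal_bounded[of "range ord_of_nat"] in auto)
  then show ?thesis ..
qed

lemma less_omega_iff: "\<alpha> < omega \<longleftrightarrow> (\<exists>n. \<alpha> = ord_of_nat n)"
proof
  assume "\<alpha> < omega"
  then obtain n where "\<alpha> \<le> ord_of_nat n"
    unfolding omega_def using not_less_Least[of \<alpha> "\<lambda>\<alpha>. \<forall>n. ord_of_nat n < \<alpha>"]
    by (auto simp: not_less)
  then show "\<exists>n. \<alpha> = ord_of_nat n"
  proof (induction n)
    case 0
    then show ?case
      using zero_le_countable_ordinal[of \<alpha>] by (intro exI[of _ 0]) (simp add: ord_of_nat_def)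
  next
    case (Suc n)
    then show ?case
      by (metis less_osucc_iff ord_of_nat_def funpow.simps(2) comp_apply le_less)
  qed
qed (auto simp: ord_of_nat_less_omega)

text \<open>The ordinal sum \<open>1 + \<alpha>\<close>, which is \<open>\<alpha>\<close> itself as soon as \<open>\<alpha>\<close> is infinite.\<close>

definition one_oplus :: "countable_ordinal \<Rightarrow> countable_ordinal" where
  "one_oplus \<alpha> = (if \<alpha> < omega then osucc \<alpha> else \<alpha>)"


section \<open>Tree partitions and the ideals \<open>\<H>\<^sub>\<alpha>\<close>\<close>

text \<open>Nodes \<open>s \<in> \<omega>\<^bsup><\<omega>\<^esup>\<close> are lists of naturals; \<open>s\<close> extended by \<open>n\<close> is \<open>s @ [n]\<close>.\<close>

definition tree_partition :: "(nat list \<Rightarrow> nat set) \<Rightarrow> bool" where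
  "tree_partition A \<longleftrightarrow>
     (\<forall>s. infinite (A s)) \<and>
     A [] = UNIV \<and>
     (\<forall>s. (\<Union>n. A (s @ [n])) = A s \<and> disjoint_family (\<lambda>n. A (s @ [n]))) \<and>
     (\<forall>x y. x \<noteq> y \<longrightarrow>
        (\<exists>s t. length s = length t \<and> A s \<noteq> A t \<and> x \<in> A s \<and> y \<in> A t))"

definition T_inf :: "(nat list \<Rightarrow> nat set) \<Rightarrow> nat set \<Rightarrow> nat list set" where
  "T_inf A X = {s. infinite (X \<inter> A s)}"

definition Succ :: "nat list set \<Rightarrow> nat list \<Rightarrow> nat set" where
  "Succ T s = {n. s @ [n] \<in> T}"

definition D :: "nat list set \<Rightarrow> nat list set" where
  "D T = {s \<in> T. infinite (Succ T s)}"

function D_iter :: "countable_ordinal \<Rightarrow> nat list set \<Rightarrow> nat list set" where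
  "D_iter \<alpha> T =
     (if \<alpha> = 0 then T
      else if \<exists>\<beta>. \<alpha> = osucc \<beta> then D (D_iter (THE \<beta>. \<alpha> = osucc \<beta>) T)
      else \<Inter>\<beta>\<in>{..<\<alpha>}. D_iter \<beta> T)"
  by pat_completeness auto
termination
proof (relation "inv_image {(\<beta>, \<alpha>). \<beta> < \<alpha>} fst")
  show "wf (inv_image {(\<beta> :: countable_ordinal, \<alpha>). \<beta> < \<alpha>} fst)"
    by (intro wf_inv_image wf)
next
  fix \<alpha> :: countable_ordinal and T :: "nat list set"
  assume "\<exists>\<beta>. \<alpha> = osucc \<beta>"
  then obtain \<beta> where "\<alpha> = osucc \<beta>" ..
  then show "((THE \<beta>. \<alpha> = osucc \<beta>, T), (\<alpha>, T)) \<in> inv_image {(\<beta>, \<alpha>). \<beta> < \<alpha>} fst"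
    by (simp add: osucc_inject less_osucc)
qed auto

declare D_iter.simps [simp del]

lemma D_iter_0: "D_iter 0 T = T"
  by (simp add: D_iter.simps)

lemma D_iter_osucc: "D_iter (osucc \<alpha>) T = D (D_iter \<alpha> T)"
proof -
  have "osucc \<alpha> \<noteq> 0"
    using zero_le_countable_ordinal[of \<alpha>] less_osucc[of \<alpha>] by auto
  moreover have "(THE \<beta>. osucc \<alpha> = osucc \<beta>) = \<alpha>"
    by (simp add: osucc_inject)
  ultimately show ?thesis
    by (subst D_iter.simps) auto
qed

lemma D_iter_limit:
  "\<alpha> \<noteq> 0 \<Longrightarrow> (\<And>\<beta>. \<alpha> \<noteq> osucc \<beta>) \<Longrightarrow> D_iter \<alpha> T = (\<Inter>\<beta>\<in>{..<\<alpha>}. D_iter \<beta> T)"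
  by (subst D_iter.simps) auto

definition H_ideal :: "(nat list \<Rightarrow> nat set) \<Rightarrow> countable_ordinal \<Rightarrow> nat set set" where
  "H_ideal A \<alpha> = {X. [] \<notin> D_iter \<alpha> (T_inf A X)}"

definition H_below_omega :: "(nat list \<Rightarrow> nat set) \<Rightarrow> nat set set" where
  "H_below_omega A = (\<Union>n. H_ideal A (ord_of_nat n))"


section \<open>Ideals and the Katetov-type orders\<close>

text \<open>Ideals are proper and contain all finite subsets of the underlying set \<open>X\<close>. Hence \<open>X = \<Union>I\<close>, and
  the relations below recover \<open>dom I\<close> as \<open>\<Union>I\<close>.\<close>

definition ideal_on :: "'a set \<Rightarrow> 'a set set \<Rightarrow> bool" where
  "ideal_on X I \<longleftrightarrow>
     I \<subseteq> Pow X \<and> X \<notin> I \<and>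
     (\<forall>F. finite F \<and> F \<subseteq> X \<longrightarrow> F \<in> I) \<and>
     (\<forall>B\<in>I. \<forall>C. C \<subseteq> B \<longrightarrow> C \<in> I) \<and>
     (\<forall>B\<in>I. \<forall>C\<in>I. B \<union> C \<in> I)"

abbreviation (input) dom_ideal :: "'a set set \<Rightarrow> 'a set" where
  "dom_ideal I \<equiv> \<Union>I"

lemma ideal_on_dom: "ideal_on X I \<Longrightarrow> dom_ideal I = X"
  unfolding ideal_on_def by (auto intro: UnionI[of "{_}"])

definition dual_filter :: "'a set set \<Rightarrow> 'a set set" where
  "dual_filter I = {dom_ideal I - B | B. B \<in> I}"

definition tall :: "'a set set \<Rightarrow> bool" where
  "tall I \<longleftrightarrow> (\<forall>X. X \<subseteq> dom_ideal I \<and> infinite X \<longrightarrow> (\<exists>B\<in>I. infinite B \<and> B \<subseteq> X))"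

definition Katetov_le :: "'a set set \<Rightarrow> 'b set set \<Rightarrow> bool" (infix \<open>\<le>\<^sub>K\<close> 50) where
  "I \<le>\<^sub>K J \<longleftrightarrow>
     (\<exists>f \<in> dom_ideal J \<rightarrow> dom_ideal I. \<forall>B\<in>I. f -` B \<inter> dom_ideal J \<in> J)"

definition Katetov_Blass_le :: "'a set set \<Rightarrow> 'b set set \<Rightarrow> bool" (infix \<open>\<le>\<^sub>K\<^sub>B\<close> 50) where
  "I \<le>\<^sub>K\<^sub>B J \<longleftrightarrow>
     (\<exists>f \<in> dom_ideal J \<rightarrow> dom_ideal I.
        (\<forall>y \<in> dom_ideal I. finite (f -` {y} \<inter> dom_ideal J)) \<and>
        (\<forall>B\<in>I. f -` B \<inter> dom_ideal J \<in> J))"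

definition iso_below :: "'a set set \<Rightarrow> 'b set set \<Rightarrow> bool" (infix \<open>\<sqsubseteq>\<close> 50) where
  "I \<sqsubseteq> J \<longleftrightarrow>
     (\<exists>f. bij_betw f (dom_ideal J) (dom_ideal I) \<and> (\<forall>B\<in>I. f -` B \<inter> dom_ideal J \<in> J))"


section \<open>Borel classes and the separation rank\<close>

text \<open>\<open>\<P>(X)\<close> is identified with \<open>{0,1}\<^bsup>X\<^esup>\<close> via characteristic functions.\<close>

definition powerset_topology :: "'a set \<Rightarrow> 'a set topology" where
  "powerset_topology X =
     pullback_topology (Pow X) (\<lambda>B. \<lambda>x\<in>X. x \<in> B)
       (product_topology (\<lambda>_. discrete_topology (UNIV :: bool set)) X)"

text \<open>\<open>Sigma0 T \<xi> S\<close>: the set \<open>S\<close> is \<open>\<Sigma>\<^sup>0\<^sub>\<xi>\<close> in the space \<open>T\<close>, for \<open>1 \<le> \<xi> < \<omega>\<^sub>1\<close>; there are no sets of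
  class \<open>\<Sigma>\<^sup>0\<^sub>0\<close>.\<close>

inductive Sigma0 :: "'a topology \<Rightarrow> countable_ordinal \<Rightarrow> 'a set \<Rightarrow> bool" for T where
  Sigma0_open: "openin T U \<Longrightarrow> Sigma0 T 1 U"
| Sigma0_Union:
    "1 < \<xi> \<Longrightarrow>
     (\<And>n. B n \<subseteq> topspace T \<and> (\<exists>\<eta>. 1 \<le> \<eta> \<and> \<eta> < \<xi> \<and> Sigma0 T \<eta> (topspace T - B n))) \<Longrightarrow>
     Sigma0 T \<xi> (\<Union>n :: nat. B n)"

definition Sigma0_separated :: "'a set set \<Rightarrow> countable_ordinal \<Rightarrow> bool" where
  "Sigma0_separated I \<alpha> \<longleftrightarrow>
     (\<exists>S. Sigma0 (powerset_topology (dom_ideal I)) (one_oplus \<alpha>) S \<and>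
          I \<subseteq> S \<and> S \<inter> dual_filter I = {})"

text \<open>A relation rather than a function, since a non-analytic ideal need not have a countable rank.\<close>

definition has_separation_rank :: "'a set set \<Rightarrow> countable_ordinal \<Rightarrow> bool" where
  "has_separation_rank I \<alpha> \<longleftrightarrow>
     Sigma0_separated I \<alpha> \<and> (\<forall>\<beta><\<alpha>. \<not> Sigma0_separated I \<beta>)"


section \<open>Finite Fubini powers and Kwela's ideal\<close>

text \<open>\<open>Fin_pow r\<close> lives on \<open>\<omega>\<^sup>r\<close>, the lists of length \<open>r\<close>. The ideal \<open>Fin_pow 0\<close> on a one-point set is
  only an anchor for the recursion: it makes \<open>Fin_pow 1\<close> the ideal of finite sets.\<close>

primrec Fin_pow :: "nat \<Rightarrow> nat list set set" where
  "Fin_pow 0 = {{}}"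
| "Fin_pow (Suc k) =
     {C. C \<subseteq> {t. length t = Suc k} \<and> finite {n. {t. n # t \<in> C} \<notin> Fin_pow k}}"

lemma Fin_pow_1: "Fin_pow 1 = {C. C \<subseteq> {t. length t = 1} \<and> finite C}"
proof -
  have "finite {n. {t. n # t \<in> C} \<noteq> {}} \<longleftrightarrow> finite C" if C: "C \<subseteq> {t. length t = 1}"
    for C :: "nat list set"
  proof -
    have "{n. {t. n # t \<in> C} \<noteq> {}} = hd ` C"
      using C by (force simp: length_Suc_conv)
    moreover have "inj_on hd C"
    proof (rule inj_onI)
      fix t u assume "t \<in> C" "u \<in> C" "hd t = hd u"
      moreover from this have "length t = 1" "length u = 1" using C by auto
      ultimately show "t = u" by (auto simp: length_Suc_conv)
    qed
    ultimately show ?thesis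
      by (simp add: finite_image_iff)
  qed
  then show ?thesis by auto
qed

text \<open>A sequence of partitions of \<open>\<omega>\<close>, the \<open>r\<close>-th one (\<open>r \<ge> 1\<close>) having the cells \<open>P r -` {t}\<close> for
  \<open>t \<in> \<omega>\<^sup>r\<close>. It is independent if picking one cell from each of finitely many of the partitions always
  leaves an infinite intersection.\<close>

definition independent_partitions :: "(nat \<Rightarrow> nat \<Rightarrow> nat list) \<Rightarrow> bool" where
  "independent_partitions P \<longleftrightarrow>
     (\<forall>r\<ge>1. \<forall>x. length (P r x) = r) \<and>
     (\<forall>R c. finite R \<and> R \<subseteq> {1..} \<and> (\<forall>r\<in>R. length (c r) = r) \<longrightarrow>
        infinite (\<Inter>r\<in>R. P r -` {c r}))"

text \<open>The ideal \<open>Fin'\<^sub>\<omega>\<close> built on \<open>P\<close>: it is generated by the unions of cells of the \<open>r\<close>-th partition over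
  index sets in \<open>Fin\<^bsup>\<otimes>r\<^esup>\<close>, \<open>r \<ge> 1\<close>.\<close>

definition Fin'_omega :: "(nat \<Rightarrow> nat \<Rightarrow> nat list) \<Rightarrow> nat set set" where
  "Fin'_omega P =
     {C. \<exists>n B. (\<forall>r\<in>{1..n}. B r \<in> Fin_pow r) \<and> C \<subseteq> (\<Union>r\<in>{1..n}. P r -` B r)}"

lemma independent_partitions_exist: "\<exists>P. independent_partitions P"
proof -
  define val where "val l k = (if k < length l then l ! k else (0::nat))" for l k
  define P where "P r x = map (\<lambda>i. val (list_decode x) (prod_encode (r, i))) [0..<r]" for r x
  have "infinite (\<Inter>r\<in>R. P r -` {c r})"
    if R: "finite R" and c: "\<forall>r\<in>R. length (c r) = r" for R c
  proof -
    define h where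
      "h k = (case prod_decode k of (r, i) \<Rightarrow> if r \<in> R \<and> i < r then c r ! i else 0)" for k
    define K where "K = prod_encode ` (SIGMA r:R. {..<r})"
    have "finite K" using R by (simp add: K_def)
    then obtain m where m: "\<And>k. k \<in> K \<Longrightarrow> k < m"
      by (metis finite_nat_set_iff_bounded)
    define e where "e N = list_encode (map h [0..<N])" for N
    have "P r (e N) = c r" if "r \<in> R" "m \<le> N" for r N
    proof (rule nth_equalityI)
      show "length (P r (e N)) = length (c r)" using c that by (simp add: P_def)
      fix i assume "i < length (P r (e N))"
      then have i: "i < r" by (simp add: P_def)
      then have "prod_encode (r, i) < N"
        using m[of "prod_encode (r, i)"] that by (force simp: K_def)
      then show "P r (e N) ! i = c r ! i"
        using i that by (simp add: P_def e_def val_def h_def)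
    qed
    then have "e ` {m..} \<subseteq> (\<Inter>r\<in>R. P r -` {c r})" by auto
    moreover have "inj e"
      by (auto simp: inj_def e_def list_encode_eq dest: map_eq_imp_length_eq)
    then have "infinite (e ` {m..})"
      using finite_image_iff[of e "{m..}"] infinite_Ici[of m] inj_on_subset[of e UNIV "{m..}"] by auto
    ultimately show ?thesis using finite_subset by blast
  qed
  moreover have "length (P r x) = r" for r x by (simp add: P_def)
  ultimately show ?thesis unfolding independent_partitions_def by blast
qed

lemma empty_in_Fin_pow: "{} \<in> Fin_pow r"
  by (induction r) auto

lemma singleton_in_Fin_pow:
  assumes "t \<noteq> []"
  shows "{t} \<in> Fin_pow (length t)"
proof -
  obtain a u where t: "t = a # u" using assms by (cases t) auto
  have "{n. {v. n # v \<in> {a # u}} \<notin> Fin_pow (length u)} \<subseteq> {a}"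
  proof
    fix n assume n: "n \<in> {n. {v. n # v \<in> {a # u}} \<notin> Fin_pow (length u)}"
    have "{v. n # v \<in> {a # u}} = {}" if "n \<noteq> a" using that by auto
    then show "n \<in> {a}" using n empty_in_Fin_pow by fastforce
  qed
  then have "finite {n. {v. n # v \<in> {a # u}} \<notin> Fin_pow (length u)}"
    by (rule finite_subset) simp
  then show ?thesis by (simp add: t)
qed

lemma dom_Fin_pow: "dom_ideal (Fin_pow (Suc k)) = {t. length t = Suc k}"
proof
  show "dom_ideal (Fin_pow (Suc k)) \<subseteq> {t. length t = Suc k}" by auto
  show "{t. length t = Suc k} \<subseteq> dom_ideal (Fin_pow (Suc k))"
  proof
    fix t :: "nat list" assume "t \<in> {t. length t = Suc k}"
    then have "{t} \<in> Fin_pow (Suc k)" using singleton_in_Fin_pow[of t] by (force simp del: Fin_pow.simps)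
    then show "t \<in> dom_ideal (Fin_pow (Suc k))" by blast
  qed
qed

lemma vimage_in_Fin'_omega: "r \<ge> 1 \<Longrightarrow> B \<in> Fin_pow r \<Longrightarrow> P r -` B \<in> Fin'_omega P"
  unfolding Fin'_omega_def using empty_in_Fin_pow
  by (intro CollectI exI[of _ r] exI[of _ "\<lambda>q. if q = r then B else {}"]) auto

lemma dom_Fin'_omega:
  assumes "independent_partitions P"
  shows "dom_ideal (Fin'_omega P) = UNIV"
proof -
  have "x \<in> dom_ideal (Fin'_omega P)" for x
  proof -
    have "length (P 1 x) = 1" using assms by (simp add: independent_partitions_def)
    then have "P 1 -` {P 1 x} \<in> Fin'_omega P"
      using vimage_in_Fin'_omega[of 1 "{P 1 x}" P] singleton_in_Fin_pow[of "P 1 x"]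
      by (force simp del: Fin_pow.simps)
    then show ?thesis by blast
  qed
  then show ?thesis by blast
qed

text \<open>The property characterising \<open>Fin'\<^sub>\<omega>\<close> in the Katetov order.\<close>

lemma Fin'_omega_Katetov_le_iff:
  assumes P: "independent_partitions P" and Y: "countable Y" and J: "ideal_on Y J"
  shows "Fin'_omega P \<le>\<^sub>K J \<longleftrightarrow> (\<forall>r\<ge>1. Fin_pow r \<le>\<^sub>K J)"
proof
  have lenP: "length (P r x) = r" if "r \<ge> 1" for r x
    using P that by (simp add: independent_partitions_def)
  have domF: "dom_ideal (Fin_pow r) = {t. length t = r}" if "r \<ge> 1" for r
    using dom_Fin_pow[of "r - 1"] that by (simp del: Fin_pow.simps)
  note domJ = ideal_on_dom[OF J]
  {
    assume "Fin'_omega P \<le>\<^sub>K J"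
    then obtain f where f: "\<And>C. C \<in> Fin'_omega P \<Longrightarrow> f -` C \<inter> Y \<in> J"
      unfolding Katetov_le_def domJ by blast
    show "\<forall>r\<ge>1. Fin_pow r \<le>\<^sub>K J"
    proof (intro allI impI)
      fix r :: nat assume r: "r \<ge> 1"
      have "(P r \<circ> f) -` B \<inter> Y \<in> J" if "B \<in> Fin_pow r" for B
        using f[OF vimage_in_Fin'_omega[OF r that]] by (simp add: vimage_comp)
      then show "Fin_pow r \<le>\<^sub>K J"
        unfolding Katetov_le_def domJ domF[OF r]
        by (intro bexI[of _ "P r \<circ> f"]) (auto simp: lenP[OF r])
    qed
  }
  assume "\<forall>r\<ge>1. Fin_pow r \<le>\<^sub>K J"
  then have "\<exists>g. (\<forall>y\<in>Y. length (g y) = r) \<and> (\<forall>B\<in>Fin_pow r. g -` B \<inter> Y \<in> J)"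
    if r: "r \<ge> 1" for r
    using r unfolding Katetov_le_def domJ using domF[OF r] by blast
  then obtain g where
    g: "\<And>r. r \<ge> 1 \<Longrightarrow> (\<forall>y\<in>Y. length (g r y) = r) \<and> (\<forall>B\<in>Fin_pow r. g r -` B \<inter> Y \<in> J)"
    by metis
  have g_len: "length (g r y) = r" if "r \<ge> 1" "y \<in> Y" for r y
    using g that by blast
  have g_J: "g r -` B \<inter> Y \<in> J" if "r \<ge> 1" "B \<in> Fin_pow r" for r B
    using g that by blast
  have sub: "C \<in> J" if "B \<in> J" "C \<subseteq> B" for B C using J that by (auto simp: ideal_on_def)
  have un: "B \<union> C \<in> J" if "B \<in> J" "C \<in> J" for B C using J that by (auto simp: ideal_on_def)
  have fin: "F \<in> J" if "finite F" "F \<subseteq> Y" for F using J that by (auto simp: ideal_on_def)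
  define e where "e = to_nat_on Y"
  have inj: "inj_on e Y" unfolding e_def using Y by (rule inj_on_to_nat_on)
  have "\<exists>x. \<forall>r\<in>{1..e y}. P r x = g r y" if y: "y \<in> Y" for y
  proof -
    have "infinite (\<Inter>r\<in>{1..e y}. P r -` {g r y})"
      using P g_len y unfolding independent_partitions_def by auto
    then obtain x where "x \<in> (\<Inter>r\<in>{1..e y}. P r -` {g r y})"
      using not_finite_existsD by (metis ex_in_conv finite.emptyI)
    then show ?thesis by auto
  qed
  then obtain f where f: "\<And>y r. y \<in> Y \<Longrightarrow> r \<in> {1..e y} \<Longrightarrow> P r (f y) = g r y" by metis
  have one: "f -` (P r -` B) \<inter> Y \<in> J" if r: "r \<ge> 1" and B: "B \<in> Fin_pow r" for r B
  proof -
    have "finite {y \<in> Y. e y < r}"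
      using inj by (intro finite_imageD[of e]) (auto intro: finite_subset[of _ "{..<r}"] inj_on_subset)
    then have "{y \<in> Y. e y < r} \<in> J" by (intro fin) auto
    moreover have "f -` (P r -` B) \<inter> Y \<subseteq> (g r -` B \<inter> Y) \<union> {y \<in> Y. e y < r}"
      using f r by (force simp: not_less)
    ultimately show ?thesis using sub un g_J[OF r B] by meson
  qed
  have "f -` C \<inter> Y \<in> J" if gen: "C \<in> Fin'_omega P" for C
  proof -
    obtain n B where B: "\<forall>r\<in>{1..n}. B r \<in> Fin_pow r"
      and C: "C \<subseteq> (\<Union>r\<in>{1..n}. P r -` B r)"
      using gen unfolding Fin'_omega_def by blast
    have "(\<Union>r\<in>R. f -` (P r -` B r) \<inter> Y) \<in> J" if "finite R" "R \<subseteq> {1..n}" for R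
      using that
    proof (induction R)
      case (insert r R)
      then have "f -` (P r -` B r) \<inter> Y \<in> J" using one[of r "B r"] B by auto
      then show ?case using insert un by auto
    qed (simp add: fin)
    then have "(\<Union>r\<in>{1..n}. f -` (P r -` B r) \<inter> Y) \<in> J" by blast
    moreover have "f -` C \<inter> Y \<subseteq> (\<Union>r\<in>{1..n}. f -` (P r -` B r) \<inter> Y)"
    proof
      fix y assume y: "y \<in> f -` C \<inter> Y"
      then have "f y \<in> (\<Union>r\<in>{1..n}. P r -` B r)" using C by blast
      then obtain r where "r \<in> {1..n}" "P r (f y) \<in> B r" by blast
      then show "y \<in> (\<Union>r\<in>{1..n}. f -` (P r -` B r) \<inter> Y)" using y by blast
    qed
    ultimately show ?thesis by (rule sub)
  qed
  then show "Fin'_omega P \<le>\<^sub>K J"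
    unfolding Katetov_le_def domJ dom_Fin'_omega[OF P] by (intro bexI[of _ f]) auto
qed

end

theory Submission
  imports Defs
begin

text \<open>
  Membership in \<open>\<H>\<^sub>n\<close> is a condition on the root of the tree: \<open>X\<close> is positive at a node \<open>s\<close> for
  rank \<open>0\<close> if it meets the cell of \<open>s\<close> in an infinite set, and for rank \<open>n + 1\<close> if it is positive for
  rank \<open>n\<close> at infinitely many children of \<open>s\<close>; and \<open>\<H>\<^sub>n\<close> collects the sets that are not positive at
  the root (\<open>positive_at_Suc\<close>). From this recursion one reads off that the \<open>\<H>\<^sub>n\<close> form an increasing
  chain of ideals, that already \<open>\<H>\<^sub>1\<close> is tall, that \<open>\<H>\<^sub>n\<close> has a finite Borel class, and, most
  importantly, that a union of cells \<open>A t\<close> with \<open>t\<close> ranging over a member of \<open>Fin\<^bsup>\<otimes>n\<^esup>\<close> lies in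
  \<open>\<H>\<^sub>n\<close> (\<open>not_positive_at_Fin_pow\<close>).

  The separation rank is at most \<open>\<omega>\<close> because \<open>\<H>\<^bsub><\<omega>\<^esub>\<close> itself is of class \<open>\<Sigma>\<^sup>0\<^sub>\<omega>\<close>. For the lower
  bound, every \<open>\<Sigma>\<^sup>0\<^sub>n\<close> set \<open>S\<close> is an \<open>n\<close>-fold iterated limit of conditions each of which inspects
  only finitely many points: there are such conditions \<open>f t\<close>, for \<open>t \<in> \<omega>\<^sup>n\<close>, which for every \<open>X\<close>
  answer the question whether \<open>X \<in> S\<close> correctly except for a set of indices \<open>t\<close> in \<open>Fin\<^bsup>\<otimes>n\<^esup>\<close>
  (\<open>Sigma0_imp_iterated_limit\<close>). This allows a diagonal construction: decide the points \<open>q\<close> one after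
  the other, putting \<open>q\<close> into \<open>X\<close> iff the condition indexed by the node \<open>t\<close> of length \<open>n\<close> with
  \<open>q \<in> A t\<close> holds of the part of \<open>X\<close> built so far. The points at which the answer is wrong form a
  set in \<open>\<H>\<^sub>n\<close>, so \<open>X \<in> S\<close> puts \<open>X\<close> into the dual filter of \<open>\<H>\<^sub>n\<close>, and \<open>X \<notin> S\<close> puts \<open>X\<close> into
  \<open>\<H>\<^sub>n\<close>. Hence \<open>S\<close> does not separate the ideal from its dual filter
  (\<open>iterated_limit_does_not_separate\<close>).

  The same lemma gives strictness: a map \<open>h\<close> witnessing \<open>\<H>\<^bsub><\<omega>\<^esub> \<le>\<^sub>K \<H>\<^sub>n\<close> would make
  \<open>{X. h -` X \<in> \<H>\<^sub>n}\<close> a separating set of finite Borel class. The positive comparisons are given by the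
  identity.

  Finally, sending a point to the node of length \<open>r\<close> whose cell contains it pulls \<open>Fin\<^bsup>\<otimes>r\<^esup>\<close> back into
  \<open>\<H>\<^bsub><\<omega>\<^esub>\<close>, for every \<open>r\<close>. Independence of the partitions merges these maps into a single injective
  map into the domain of \<open>Fin'\<^sub>\<omega>\<close>, and values on an infinite set of the ideal \<open>\<H>\<^bsub><\<omega>\<^esub>\<close> can be
  changed freely to make it surjective (\<open>Fin'_omega_iso_below\<close>).
\<close>

section \<open>Ideals and finite Fubini powers\<close>

lemma ideal_on_subset: "ideal_on X I \<Longrightarrow> B \<in> I \<Longrightarrow> C \<subseteq> B \<Longrightarrow> C \<in> I"
  and ideal_on_Un: "ideal_on X I \<Longrightarrow> B \<in> I \<Longrightarrow> C \<in> I \<Longrightarrow> B \<union> C \<in> I"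
  and ideal_on_finite: "ideal_on X I \<Longrightarrow> finite F \<Longrightarrow> F \<subseteq> X \<Longrightarrow> F \<in> I"
  by (simp_all add: ideal_on_def)

lemma ideal_on_Compl:
  assumes I: "ideal_on UNIV I" and B: "B \<in> I"
  shows "- B \<notin> I"
proof
  assume "- B \<in> I"
  from ideal_on_Un[OF I this B] show False using I by (simp add: ideal_on_def)
qed

lemma Fin_pow_subset: "C \<in> Fin_pow r \<Longrightarrow> B \<subseteq> C \<Longrightarrow> B \<in> Fin_pow r"
proof (induction r arbitrary: B C)
  case 0
  then show ?case by auto
next
  case (Suc r)
  have "{n. {t. n # t \<in> B} \<notin> Fin_pow r} \<subseteq> {n. {t. n # t \<in> C} \<notin> Fin_pow r}"
    using Suc.IH[of "{t. _ # t \<in> C}" "{t. _ # t \<in> B}"] Suc.prems(2) by blast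
  then show ?case using Suc.prems by (auto intro: finite_subset)
qed

lemma Fin_pow_Un: "B \<in> Fin_pow r \<Longrightarrow> C \<in> Fin_pow r \<Longrightarrow> B \<union> C \<in> Fin_pow r"
proof (induction r arbitrary: B C)
  case 0
  then show ?case by auto
next
  case (Suc r)
  have "{n. {t. n # t \<in> B \<union> C} \<notin> Fin_pow r}
      \<subseteq> {n. {t. n # t \<in> B} \<notin> Fin_pow r} \<union> {n. {t. n # t \<in> C} \<notin> Fin_pow r}"
  proof
    fix n assume n: "n \<in> {n. {t. n # t \<in> B \<union> C} \<notin> Fin_pow r}"
    have "{t. n # t \<in> B \<union> C} = {t. n # t \<in> B} \<union> {t. n # t \<in> C}" by blast
    then show "n \<in> {n. {t. n # t \<in> B} \<notin> Fin_pow r} \<union> {n. {t. n # t \<in> C} \<notin> Fin_pow r}"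
      using n Suc.IH[of "{t. n # t \<in> B}" "{t. n # t \<in> C}"] by auto
  qed
  then show ?case using Suc.prems by (auto intro: finite_subset)
qed

section \<open>Iterated limits of finitely determined conditions\<close>

text \<open>The characteristic functions of the clopen subsets of the Cantor space \<open>\<P>(\<omega>)\<close>.\<close>

definition finitely_determined :: "(nat set \<Rightarrow> bool) \<Rightarrow> bool" where
  "finitely_determined g \<longleftrightarrow> (\<exists>N. \<forall>X Y. X \<inter> {..<N} = Y \<inter> {..<N} \<longrightarrow> g X = g Y)"

text \<open>The membership of \<open>X\<close> in \<open>S\<close> is computed as \<open>lim\<^bsub>k\<^sub>1\<^esub> \<dots> lim\<^bsub>k\<^sub>m\<^esub> f (k\<^sub>1, \<dots>, k\<^sub>m) X\<close>, the
  limits being those of eventually constant sequences. Demanding that the set of wrong indices be in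
  \<open>Fin\<^bsup>\<otimes>m\<^esup>\<close> is a way to say this without naming the intermediate limits.\<close>

definition iterated_limit :: "nat \<Rightarrow> nat set set \<Rightarrow> bool" where
  "iterated_limit m S \<longleftrightarrow>
     (\<exists>f. (\<forall>t. finitely_determined (f t)) \<and>
          (\<forall>X. {t. length t = m \<and> f t X \<noteq> (X \<in> S)} \<in> Fin_pow m))"

lemma iterated_limitI:
  assumes "\<And>t. finitely_determined (f t)"
    and "\<And>X. {t. length t = m \<and> f t X \<noteq> (X \<in> S)} \<in> Fin_pow m"
  shows "iterated_limit m S"
  using assms unfolding iterated_limit_def by blast

lemma iterated_limit_0: "finitely_determined (\<lambda>X. X \<in> S) \<Longrightarrow> iterated_limit 0 S"
  by (rule iterated_limitI[where f = "\<lambda>t X. X \<in> S"]) auto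

lemma iterated_limit_Suc:
  assumes "iterated_limit m S"
  shows "iterated_limit (Suc m) S"
proof -
  obtain f where f: "\<And>t. finitely_determined (f t)"
      "\<And>X. {t. length t = m \<and> f t X \<noteq> (X \<in> S)} \<in> Fin_pow m"
    using assms unfolding iterated_limit_def by blast
  show ?thesis
    by (rule iterated_limitI[where f = "\<lambda>t. f (tl t)"]) (use f in auto)
qed

lemma iterated_limit_mono:
  assumes "iterated_limit m S" "m \<le> n"
  shows "iterated_limit n S"
  using assms(2,1) by (induction rule: dec_induct) (auto intro: iterated_limit_Suc)

lemma finitely_determined_Not: "finitely_determined g \<Longrightarrow> finitely_determined (\<lambda>X. \<not> g X)"
  by (simp add: finitely_determined_def)

lemma finitely_determined_disj:
  assumes "finitely_determined g" "finitely_determined h"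
  shows "finitely_determined (\<lambda>X. g X \<or> h X)"
proof -
  obtain M where M: "\<And>X Y. X \<inter> {..<M} = Y \<inter> {..<M} \<Longrightarrow> g X = g Y"
    using assms(1) unfolding finitely_determined_def by blast
  obtain N where N: "\<And>X Y. X \<inter> {..<N} = Y \<inter> {..<N} \<Longrightarrow> h X = h Y"
    using assms(2) unfolding finitely_determined_def by blast
  have "(g X \<or> h X) = (g Y \<or> h Y)" if "X \<inter> {..<max M N} = Y \<inter> {..<max M N}" for X Y
  proof -
    have "X \<inter> {..<K} = Y \<inter> {..<K}" if K: "K \<le> max M N" for K
      using \<open>X \<inter> {..<max M N} = Y \<inter> {..<max M N}\<close> K by (force simp: set_eq_iff)
    then show ?thesis using M[of X Y] N[of X Y] by simp
  qed
  then show ?thesis unfolding finitely_determined_def by blast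
qed

lemma finitely_determined_vimage:
  assumes "finitely_determined g"
  shows "finitely_determined (\<lambda>X. g (h -` X))"
proof -
  obtain N where N: "\<And>X Y. X \<inter> {..<N} = Y \<inter> {..<N} \<Longrightarrow> g X = g Y"
    using assms unfolding finitely_determined_def by blast
  obtain M where M: "\<And>i. i < N \<Longrightarrow> h i < M"
    using finite_nat_set_iff_bounded[of "h ` {..<N}"] by auto
  have "g (h -` X) = g (h -` Y)" if "X \<inter> {..<M} = Y \<inter> {..<M}" for X Y
  proof (rule N)
    show "h -` X \<inter> {..<N} = h -` Y \<inter> {..<N}"
      using that M by (fastforce simp: set_eq_iff)
  qed
  then show ?thesis unfolding finitely_determined_def by blast
qed

lemma iterated_limit_Compl:
  assumes "iterated_limit m S"
  shows "iterated_limit m (- S)"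
proof -
  obtain f where f: "\<And>t. finitely_determined (f t)"
      "\<And>X. {t. length t = m \<and> f t X \<noteq> (X \<in> S)} \<in> Fin_pow m"
    using assms unfolding iterated_limit_def by blast
  show ?thesis
  proof (rule iterated_limitI[where f = "\<lambda>t X. \<not> f t X"])
    show "{t. length t = m \<and> (\<not> f t X) \<noteq> (X \<in> - S)} \<in> Fin_pow m" for X
      using f(2)[of X] by simp
  qed (rule finitely_determined_Not[OF f(1)])
qed

lemma iterated_limit_Un:
  assumes "iterated_limit m S" "iterated_limit m S'"
  shows "iterated_limit m (S \<union> S')"
proof -
  obtain f where f: "\<And>t. finitely_determined (f t)"
      "\<And>X. {t. length t = m \<and> f t X \<noteq> (X \<in> S)} \<in> Fin_pow m"
    using assms(1) unfolding iterated_limit_def by blast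
  obtain f' where f': "\<And>t. finitely_determined (f' t)"
      "\<And>X. {t. length t = m \<and> f' t X \<noteq> (X \<in> S')} \<in> Fin_pow m"
    using assms(2) unfolding iterated_limit_def by blast
  show ?thesis
  proof (rule iterated_limitI[where f = "\<lambda>t X. f t X \<or> f' t X"])
    show "{t. length t = m \<and> (f t X \<or> f' t X) \<noteq> (X \<in> S \<union> S')} \<in> Fin_pow m" for X
      using Fin_pow_Un[OF f(2)[of X] f'(2)[of X]] by (rule Fin_pow_subset) auto
  qed (rule finitely_determined_disj[OF f(1) f'(1)])
qed

lemma iterated_limit_vimage:
  assumes "iterated_limit m S"
  shows "iterated_limit m {X. h -` X \<in> S}"
proof -
  obtain f where f: "\<And>t. finitely_determined (f t)"
      "\<And>X. {t. length t = m \<and> f t X \<noteq> (X \<in> S)} \<in> Fin_pow m"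
    using assms unfolding iterated_limit_def by blast
  show ?thesis
  proof (rule iterated_limitI[where f = "\<lambda>t X. f t (h -` X)"])
    show "{t. length t = m \<and> f t (h -` X) \<noteq> (X \<in> {X. h -` X \<in> S})} \<in> Fin_pow m" for X
      using f(2)[of "h -` X"] by simp
  qed (rule finitely_determined_vimage[OF f(1)])
qed

text \<open>The union is the pointwise limit of its finite partial unions, and these are handled by
  \<open>iterated_limit_Un\<close>; the new outermost index says how many sets have been united.\<close>

lemma iterated_limit_UNION:
  assumes "\<And>i :: nat. iterated_limit m (S i)"
  shows "iterated_limit (Suc m) (\<Union>i. S i)"
proof -
  have "iterated_limit m (\<Union>i\<le>k. S i)" for k
    by (induction k) (auto simp: atMost_Suc assms intro: iterated_limit_Un)
  then have "\<forall>k. \<exists>f. (\<forall>t. finitely_determined (f t)) \<and>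
      (\<forall>X. {t. length t = m \<and> f t X \<noteq> (X \<in> (\<Union>i\<le>k. S i))} \<in> Fin_pow m)"
    unfolding iterated_limit_def by blast
  then obtain f where fd: "\<And>k t. finitely_determined (f k t)"
    and f: "\<And>k X. {t. length t = m \<and> f k t X \<noteq> (X \<in> (\<Union>i\<le>k. S i))} \<in> Fin_pow m"
    by metis
  show ?thesis
  proof (rule iterated_limitI[where f = "\<lambda>t. f (hd t) (tl t)"])
    fix X
    let ?E = "{t. length t = Suc m \<and> f (hd t) (tl t) X \<noteq> (X \<in> (\<Union>i. S i))}"
    obtain k0 where k0: "X \<in> (\<Union>i. S i) \<Longrightarrow> X \<in> S k0" by blast
    have "{t. k # t \<in> ?E} \<in> Fin_pow m" if "k0 \<le> k" for k
    proof -
      have "(X \<in> (\<Union>i. S i)) = (X \<in> (\<Union>i\<le>k. S i))" using k0 that by blast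
      then show ?thesis using f[of k X] by simp
    qed
    then have "{k. {t. k # t \<in> ?E} \<notin> Fin_pow m} \<subseteq> {..<k0}"
      unfolding lessThan_def not_le[symmetric] by blast
    then have "finite {k. {t. k # t \<in> ?E} \<notin> Fin_pow m}" by (rule finite_subset) simp
    moreover have "?E \<subseteq> {t. length t = Suc m}" by blast
    ultimately show "?E \<in> Fin_pow (Suc m)" by simp
  qed (rule fd)
qed

section \<open>Finite Borel classes\<close>

lemma topspace_powerset_topology: "topspace (powerset_topology X) = Pow X"
  by (auto simp: powerset_topology_def topspace_pullback_topology)

lemma openin_powerset_topology_member: "openin (powerset_topology UNIV) {X. q \<in> X}"
proof -
  let ?P = "product_topology (\<lambda>_. discrete_topology (UNIV :: bool set)) UNIV"
  have "openin ?P {f \<in> topspace ?P. f q \<in> {True}}"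
    by (rule openin_continuous_map_preimage[OF continuous_map_product_projection]) auto
  then have "openin ?P {f. f q}" by simp
  then show ?thesis
    unfolding powerset_topology_def openin_pullback_topology
    by (intro exI[of _ "{f. f q}"]) auto
qed

lemma openin_powerset_topology_cylinder:
  fixes U :: "nat set set"
  assumes U: "openin (powerset_topology UNIV) U" and X: "X \<in> U"
  obtains N where "\<And>Y. Y \<inter> {..<N} = X \<inter> {..<N} \<Longrightarrow> Y \<in> U"
proof -
  obtain V where V: "openin (product_topology (\<lambda>_. discrete_topology (UNIV :: bool set)) UNIV) V"
    and UV: "U = (\<lambda>B. \<lambda>x\<in>UNIV. x \<in> B) -` V"
    using U unfolding powerset_topology_def openin_pullback_topology by auto
  have "(\<lambda>x. x \<in> X) \<in> V" using X UV by (simp add: restrict_UNIV)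
  then have "\<exists>W. finite {i. W i \<noteq> UNIV} \<and> (\<lambda>x. x \<in> X) \<in> Pi UNIV W \<and> Pi UNIV W \<subseteq> V"
    using V unfolding openin_product_topology_alt by (auto simp: PiE_UNIV_domain)
  then obtain W where W: "finite {i. W i \<noteq> (UNIV :: bool set)}" "\<And>i. (i \<in> X) \<in> W i"
    "Pi UNIV W \<subseteq> V"
    by (auto simp: Pi_iff)
  obtain N where N: "\<And>i. W i \<noteq> UNIV \<Longrightarrow> i < N"
    using W(1) by (auto simp: finite_nat_set_iff_bounded)
  have "Y \<in> U" if "Y \<inter> {..<N} = X \<inter> {..<N}" for Y
  proof -
    have "(i \<in> Y) \<in> W i" for i
    proof (cases "W i = UNIV")
      case False
      then have "i \<in> Y \<longleftrightarrow> i \<in> X" using N[OF False] that by (auto simp: set_eq_iff)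
      then show ?thesis using W(2)[of i] by simp
    qed simp
    then have "(\<lambda>x. x \<in> Y) \<in> V" using W(3) by (auto simp: Pi_iff)
    then show ?thesis using UV by (simp add: restrict_UNIV)
  qed
  then show ?thesis by (rule that)
qed

text \<open>An open set is the increasing union over \<open>N\<close> of the clopen sets of those \<open>X\<close> whose restriction to
  \<open>{..<N}\<close> already guarantees membership.\<close>

lemma open_imp_iterated_limit:
  assumes U: "openin (powerset_topology UNIV) U"
  shows "iterated_limit 1 U"
proof -
  define W where "W N = {X. \<forall>Y. Y \<inter> {..<N} = X \<inter> {..<N} \<longrightarrow> Y \<in> U}" for N
  have "finitely_determined (\<lambda>X. X \<in> W N)" for N
    unfolding finitely_determined_def W_def by (intro exI[of _ N]) auto
  then have "iterated_limit (Suc 0) (\<Union>N. W N)"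
    by (intro iterated_limit_UNION iterated_limit_0)
  moreover have "(\<Union>N. W N) = U"
  proof
    show "(\<Union>N. W N) \<subseteq> U" by (auto simp: W_def)
    show "U \<subseteq> (\<Union>N. W N)"
    proof
      fix X assume "X \<in> U"
      then obtain N where "\<And>Y. Y \<inter> {..<N} = X \<inter> {..<N} \<Longrightarrow> Y \<in> U"
        using openin_powerset_topology_cylinder[OF U] by metis
      then have "X \<in> W N" by (simp add: W_def)
      then show "X \<in> (\<Union>N. W N)" by blast
    qed
  qed
  ultimately show ?thesis by simp
qed

lemma ord_of_nat_0: "ord_of_nat 0 = 0"
  and ord_of_nat_Suc: "ord_of_nat (Suc n) = osucc (ord_of_nat n)"
  by (simp_all add: ord_of_nat_def)

lemma ord_of_nat_less_Suc: "ord_of_nat n < ord_of_nat (Suc n)"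
  by (simp add: ord_of_nat_Suc less_osucc)

lemma ord_of_nat_1: "ord_of_nat (Suc 0) = 1"
  by (simp add: ord_of_nat_Suc ord_of_nat_0 one_countable_ordinal_def)

lemma strict_mono_ord_of_nat: "strict_mono ord_of_nat"
  by (simp add: strict_mono_Suc_iff ord_of_nat_less_Suc)

lemma ord_of_nat_less_iff: "ord_of_nat m < ord_of_nat n \<longleftrightarrow> m < n"
  by (rule strict_mono_less[OF strict_mono_ord_of_nat])

lemma one_le_ord_of_nat_Suc: "1 \<le> ord_of_nat (Suc n)"
  using strict_mono_less_eq[OF strict_mono_ord_of_nat, of "Suc 0" "Suc n"] by (simp add: ord_of_nat_1)

text \<open>Since \<open>iterated_limit m\<close> is closed under complements, each step of the Borel hierarchy costs only
  the one additional limit that countable unions need.\<close>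

lemma Sigma0_imp_iterated_limit:
  assumes "Sigma0 (powerset_topology UNIV) \<xi> S" "\<xi> \<le> ord_of_nat n"
  shows "iterated_limit n S"
  using assms
proof (induction arbitrary: n rule: Sigma0.induct)
  case (Sigma0_open U)
  have "1 \<le> n"
    using Sigma0_open.prems strict_mono_less_eq[OF strict_mono_ord_of_nat, of "Suc 0" n]
    by (simp add: ord_of_nat_1)
  with open_imp_iterated_limit[OF Sigma0_open.hyps] show ?case
    by (rule iterated_limit_mono)
next
  case (Sigma0_Union \<xi> B)
  have "1 < ord_of_nat n"
    using Sigma0_Union.hyps(1) Sigma0_Union.prems by (rule less_le_trans)
  then have "1 < n"
    using ord_of_nat_less_iff[of "Suc 0" n] by (simp add: ord_of_nat_1)
  then obtain m where m: "n = Suc m" by (cases n) auto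
  have "iterated_limit m (B i)" for i
  proof -
    obtain \<eta> where "\<eta> < \<xi>"
      and IH: "\<And>n. \<eta> \<le> ord_of_nat n \<Longrightarrow> iterated_limit n (UNIV - B i)"
      using Sigma0_Union.IH[of i] by (auto simp: topspace_powerset_topology)
    then have "\<eta> < osucc (ord_of_nat m)"
      using Sigma0_Union.prems by (simp add: m ord_of_nat_Suc)
    then show ?thesis
      using iterated_limit_Compl[OF IH[of m]] by (simp add: less_osucc_iff double_diff Compl_eq_Diff_UNIV)
  qed
  then show ?case unfolding m by (rule iterated_limit_UNION)
qed

lemma Sigma0_UNION_Suc:
  assumes "\<And>i :: nat. Sigma0 (powerset_topology UNIV) (ord_of_nat (Suc n)) (- S i)"
  shows "Sigma0 (powerset_topology UNIV) (ord_of_nat (Suc (Suc n))) (\<Union>i. S i)"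
proof (rule Sigma0_Union)
  show "1 < ord_of_nat (Suc (Suc n))"
    using ord_of_nat_less_iff[of "Suc 0" "Suc (Suc n)"] by (simp add: ord_of_nat_1)
  show "S i \<subseteq> topspace (powerset_topology UNIV) \<and>
      (\<exists>\<eta>\<ge>1. \<eta> < ord_of_nat (Suc (Suc n)) \<and>
        Sigma0 (powerset_topology UNIV) \<eta> (topspace (powerset_topology UNIV) - S i))" for i
    using assms[of i] ord_of_nat_less_Suc[of "Suc n"] one_le_ord_of_nat_Suc[of n]
    by (auto simp: topspace_powerset_topology Compl_eq_Diff_UNIV)
qed

section \<open>The ideals of a tree partition\<close>

text \<open>Being positive at \<open>s\<close> means to survive \<open>n\<close> derivations there; \<open>positive_at_0\<close> and \<open>positive_at_Suc\<close>
  replace this by a recursion down the tree.\<close>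

definition positive_at :: "(nat list \<Rightarrow> nat set) \<Rightarrow> nat \<Rightarrow> nat set \<Rightarrow> nat list \<Rightarrow> bool" where
  "positive_at A n X s \<longleftrightarrow> s \<in> (D ^^ n) (T_inf A X)"

lemma D_iter_ord_of_nat: "D_iter (ord_of_nat n) T = (D ^^ n) T"
  by (induction n) (simp_all add: ord_of_nat_0 ord_of_nat_Suc D_iter_0 D_iter_osucc)

lemma H_ideal_ord_of_nat_iff: "X \<in> H_ideal A (ord_of_nat n) \<longleftrightarrow> \<not> positive_at A n X []"
  by (simp add: H_ideal_def positive_at_def D_iter_ord_of_nat)

lemma H_below_omega_eq: "H_below_omega A = H_ideal A omega"
proof -
  have "omega \<noteq> 0" using ord_of_nat_less_omega[of 0] by (auto simp: ord_of_nat_0)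
  moreover have "omega \<noteq> osucc \<beta>" for \<beta>
  proof
    assume \<beta>: "omega = osucc \<beta>"
    then obtain n where "\<beta> = ord_of_nat n" using less_osucc[of \<beta>] by (auto simp: less_omega_iff)
    then show False using \<beta> ord_of_nat_less_omega[of "Suc n"] by (simp add: ord_of_nat_Suc)
  qed
  ultimately have "D_iter omega T = (\<Inter>\<beta>\<in>{..<omega}. D_iter \<beta> T)" for T
    by (rule D_iter_limit)
  moreover have "{..<omega} = range ord_of_nat" by (auto simp: less_omega_iff)
  ultimately have "D_iter omega T = (\<Inter>n. D_iter (ord_of_nat n) T)" for T by simp
  then show ?thesis by (auto simp: H_below_omega_def H_ideal_def)
qed

lemma Katetov_Blass_le_imp_Katetov_le: "I \<le>\<^sub>K\<^sub>B J \<Longrightarrow> I \<le>\<^sub>K J"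
  unfolding Katetov_Blass_le_def Katetov_le_def by (elim bexE conjE) (rule bexI)

context
  fixes A :: "nat list \<Rightarrow> nat set"
  assumes A: "tree_partition A"
begin

lemma cell_infinite: "infinite (A s)"
  and cell_Nil: "A [] = UNIV"
  and cell_children: "(\<Union>n. A (s @ [n])) = A s"
  using A by (auto simp: tree_partition_def)

lemma cell_disjoint: "q \<in> A (s @ [m]) \<Longrightarrow> q \<in> A (s @ [n]) \<Longrightarrow> m = n"
  using A unfolding tree_partition_def disjoint_family_on_def by blast

lemma cell_append: "A (s @ t) \<subseteq> A s"
proof (induction t rule: rev_induct)
  case (snoc n t)
  then show ?case using cell_children[of "s @ t"] by auto
qed simp

lemma ex_cell: "\<exists>s. length s = r \<and> q \<in> A s"
proof (induction r)
  case 0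
  then show ?case by (simp add: cell_Nil)
next
  case (Suc r)
  then obtain s where "length s = r" "q \<in> A s" by blast
  moreover then obtain n where "q \<in> A (s @ [n])" using cell_children[of s] by blast
  ultimately show ?case by (intro exI[of _ "s @ [n]"]) simp
qed

lemma cell_unique: "length s = length t \<Longrightarrow> q \<in> A s \<Longrightarrow> q \<in> A t \<Longrightarrow> s = t"
proof (induction s arbitrary: t rule: rev_induct)
  case (snoc m s)
  then obtain u n where t: "t = u @ [n]" by (cases t rule: rev_cases) auto
  have "s = u"
    using snoc.prems cell_append[of s "[m]"] cell_append[of u "[n]"] by (intro snoc.IH) (auto simp: t)
  then show ?case using snoc.prems cell_disjoint by (auto simp: t)
qed simp

lemma positive_at_0: "positive_at A 0 X s \<longleftrightarrow> infinite (X \<inter> A s)"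
  by (simp add: positive_at_def T_inf_def)

lemma positive_at_decreasing: "positive_at A (Suc n) X s \<Longrightarrow> positive_at A n X s"
  by (simp add: positive_at_def D_def)

text \<open>The derivative also requires \<open>s\<close> itself to survive the first \<open>n\<close> derivations, but a node with
  infinitely many surviving children does so automatically: \<open>T_inf A X\<close> is closed under initial
  segments, and derivations preserve this.\<close>

lemma positive_at_Suc: "positive_at A (Suc n) X s \<longleftrightarrow> infinite {k. positive_at A n X (s @ [k])}"
proof -
  have "positive_at A n X s" if "infinite {k. positive_at A n X (s @ [k])}" for n
    using that
  proof (induction n)
    case 0
    then obtain k where "infinite (X \<inter> A (s @ [k]))"
      using not_finite_existsD[OF 0] by (auto simp: positive_at_0)
    then show ?case
      using cell_append[of s "[k]"] by (auto simp: positive_at_0 dest: finite_subset[rotated, of _ "X \<inter> A (s @ [k])"])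
  next
    case (Suc n)
    have "{k. positive_at A (Suc n) X (s @ [k])} \<subseteq> {k. positive_at A n X (s @ [k])}"
      using positive_at_decreasing by auto
    then have inf: "infinite {k. positive_at A n X (s @ [k])}" using Suc.prems finite_subset by blast
    with Suc.IH show ?case by (simp add: positive_at_def D_def Succ_def)
  qed
  then show ?thesis by (auto simp: positive_at_def D_def Succ_def)
qed

lemma positive_at_mono:
  "positive_at A n X s \<Longrightarrow> X \<inter> A s \<subseteq> Y \<Longrightarrow> positive_at A n Y s"
proof (induction n arbitrary: s)
  case 0
  then have "X \<inter> A s \<subseteq> Y \<inter> A s" by blast
  from infinite_super[OF this] show ?case using 0(1) by (simp add: positive_at_0)
next
  case (Suc n)
  have "{k. positive_at A n X (s @ [k])} \<subseteq> {k. positive_at A n Y (s @ [k])}"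
    using Suc.IH[of "s @ [_]"] Suc.prems(2) cell_append[of s "[_]"] by blast
  then show ?case using Suc.prems(1) finite_subset by (auto simp: positive_at_Suc)
qed

lemma positive_at_Un:
  "positive_at A n (X \<union> Y) s \<longleftrightarrow> positive_at A n X s \<or> positive_at A n Y s"
proof (induction n arbitrary: s)
  case 0
  then show ?case by (simp add: positive_at_0 Int_Un_distrib2)
next
  case (Suc n)
  then show ?case by (simp add: positive_at_Suc Collect_disj_eq)
qed

lemma positive_at_UNIV: "positive_at A n UNIV s"
  by (induction n arbitrary: s) (simp_all add: positive_at_0 positive_at_Suc cell_infinite)

lemma positive_at_imp_infinite_cell:
  "positive_at A n X s \<Longrightarrow> \<exists>t. length t = n \<and> infinite (X \<inter> A (s @ t))"
proof (induction n arbitrary: s)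
  case 0
  then show ?case by (simp add: positive_at_0)
next
  case (Suc n)
  then have "{k. positive_at A n X (s @ [k])} \<noteq> {}" by (metis finite.emptyI positive_at_Suc)
  then obtain k where "positive_at A n X (s @ [k])" by blast
  then obtain t where "length t = n" "infinite (X \<inter> A ((s @ [k]) @ t))" using Suc.IH by blast
  then show ?case by (intro exI[of _ "k # t"]) simp
qed

text \<open>The definition of \<open>Fin\<^bsup>\<otimes>(n + 1)\<^esup>\<close> and the recursion for positivity match: cells are disjoint, so
  below the child \<open>s @ [k]\<close> only the section of \<open>B\<close> at \<open>k\<close> is visible, and that section is in
  \<open>Fin\<^bsup>\<otimes>n\<^esup>\<close> for all but finitely many \<open>k\<close>.\<close>

lemma not_positive_at_Fin_pow:
  "B \<in> Fin_pow n \<Longrightarrow> \<not> positive_at A n (\<Union>t\<in>B. A (s @ t)) s"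
proof (induction n arbitrary: B s)
  case 0
  then show ?case by (simp add: positive_at_0)
next
  case (Suc n)
  have "{k. positive_at A n (\<Union>t\<in>B. A (s @ t)) (s @ [k])} \<subseteq> {k. {t. k # t \<in> B} \<notin> Fin_pow n}"
  proof safe
    fix k
    assume pos: "positive_at A n (\<Union>t\<in>B. A (s @ t)) (s @ [k])"
      and null: "{t. k # t \<in> B} \<in> Fin_pow n"
    have "(\<Union>t\<in>B. A (s @ t)) \<inter> A (s @ [k]) \<subseteq> (\<Union>t\<in>{t. k # t \<in> B}. A ((s @ [k]) @ t))"
    proof
      fix q assume "q \<in> (\<Union>t\<in>B. A (s @ t)) \<inter> A (s @ [k])"
      then obtain u where u: "u \<in> B" "q \<in> A (s @ u)" and k: "q \<in> A (s @ [k])" by blast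
      have "length u = Suc n" using u(1) Suc.prems by auto
      then obtain j t where jt: "u = j # t" by (auto simp: length_Suc_conv)
      then have "q \<in> A (s @ [j])" using u(2) cell_append[of "s @ [j]" t] by auto
      then have "j = k" using k by (rule cell_disjoint)
      then show "q \<in> (\<Union>t\<in>{t. k # t \<in> B}. A ((s @ [k]) @ t))" using u jt by auto
    qed
    with pos have "positive_at A n (\<Union>t\<in>{t. k # t \<in> B}. A ((s @ [k]) @ t)) (s @ [k])"
      by (rule positive_at_mono)
    then show False using Suc.IH[OF null] by blast
  qed
  then show ?case using Suc.prems finite_subset by (auto simp: positive_at_Suc)
qed

lemma H_ideal_increasing: "m \<le> n \<Longrightarrow> H_ideal A (ord_of_nat m) \<subseteq> H_ideal A (ord_of_nat n)"
  by (rule lift_Suc_mono_le[of "\<lambda>n. H_ideal A (ord_of_nat n)"])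
    (auto simp: H_ideal_ord_of_nat_iff dest: positive_at_decreasing)

lemma ideal_on_H_ideal: "ideal_on UNIV (H_ideal A (ord_of_nat n))"
  unfolding ideal_on_def
proof (intro conjI allI ballI impI)
  show "F \<in> H_ideal A (ord_of_nat n)" if "finite F \<and> F \<subseteq> UNIV" for F
    using that positive_at_imp_infinite_cell[of n F "[]"] by (auto simp: H_ideal_ord_of_nat_iff)
  show "C \<in> H_ideal A (ord_of_nat n)" if "B \<in> H_ideal A (ord_of_nat n)" "C \<subseteq> B" for B C
    using that positive_at_mono[of n C "[]" B] by (auto simp: H_ideal_ord_of_nat_iff)
qed (auto simp: H_ideal_ord_of_nat_iff positive_at_UNIV positive_at_Un)

lemma ideal_on_H_below_omega: "ideal_on UNIV (H_below_omega A)"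
proof -
  note I = ideal_on_H_ideal
  have H: "B \<in> H_below_omega A \<longleftrightarrow> (\<exists>n. B \<in> H_ideal A (ord_of_nat n))" for B
    by (simp add: H_below_omega_def)
  have "B \<union> C \<in> H_below_omega A" if B: "B \<in> H_below_omega A" and C: "C \<in> H_below_omega A" for B C
  proof -
    obtain m n where "B \<in> H_ideal A (ord_of_nat m)" "C \<in> H_ideal A (ord_of_nat n)"
      using B C by (auto simp: H)
    then have "B \<in> H_ideal A (ord_of_nat (max m n))" "C \<in> H_ideal A (ord_of_nat (max m n))"
      using H_ideal_increasing[of m "max m n"] H_ideal_increasing[of n "max m n"] by auto
    from ideal_on_Un[OF I this] show ?thesis by (auto simp: H)
  qed
  moreover have "UNIV \<notin> H_below_omega A"
    by (simp add: H H_ideal_ord_of_nat_iff positive_at_UNIV)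
  moreover have "F \<in> H_below_omega A" if "finite F" for F
    using ideal_on_finite[OF I that] by (auto simp: H)
  moreover have "C \<in> H_below_omega A" if "B \<in> H_below_omega A" "C \<subseteq> B" for B C
    using that unfolding H by (blast intro: ideal_on_subset[OF I])
  ultimately show ?thesis by (simp add: ideal_on_def)
qed

lemma dom_H_ideal: "\<Union>(H_ideal A (ord_of_nat n)) = UNIV"
  by (rule ideal_on_dom[OF ideal_on_H_ideal])

lemma dom_H_below_omega: "\<Union>(H_below_omega A) = UNIV"
  by (rule ideal_on_dom[OF ideal_on_H_below_omega])

lemma H_ideal_subset_H_below_omega: "H_ideal A (ord_of_nat n) \<subseteq> H_below_omega A"
  unfolding H_below_omega_def by blast

text \<open>Either \<open>X\<close> has an infinite part in infinitely many first-level cells, and a selector of one point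
  from each of these is in \<open>\<H>\<^sub>1\<close>, or \<open>X\<close> itself is in \<open>\<H>\<^sub>1\<close>.\<close>

lemma tall_H_below_omega: "tall (H_below_omega A)"
proof -
  have "\<exists>B\<in>H_ideal A (ord_of_nat 1). infinite B \<and> B \<subseteq> X" if X: "infinite X" for X
  proof (cases "infinite {k. infinite (X \<inter> A [k])}")
    case True
    define K where "K = {k. infinite (X \<inter> A [k])}"
    have "\<exists>q. q \<in> X \<inter> A [k]" if "k \<in> K" for k
      using that unfolding K_def by (metis (lifting) ex_in_conv finite.emptyI mem_Collect_eq)
    then obtain c where c: "\<And>k. k \<in> K \<Longrightarrow> c k \<in> X \<inter> A [k]" by metis
    have "inj_on c K"
      using c cell_disjoint[of _ "[]"] by (intro inj_onI) (metis IntD2 append_Nil)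
    then have inf: "infinite (c ` K)" using True by (simp add: K_def finite_image_iff)
    have "c ` K \<inter> A [k] \<subseteq> {c k}" for k
    proof
      fix q assume "q \<in> c ` K \<inter> A [k]"
      then obtain j where j: "j \<in> K" "q = c j" "q \<in> A [k]" by blast
      then have "j = k" using c[OF j(1)] cell_disjoint[of q "[]" j k] by auto
      then show "q \<in> {c k}" using j(2) by simp
    qed
    then have "finite (c ` K \<inter> A [k])" for k by (rule finite_subset) simp
    then have "\<not> positive_at A 1 (c ` K) []" by (simp add: positive_at_Suc positive_at_0)
    then have "c ` K \<in> H_ideal A (ord_of_nat 1)" by (simp only: H_ideal_ord_of_nat_iff not_False_eq_True)
    then show ?thesis using inf c by blast
  next
    case False
    then have "\<not> positive_at A 1 X []" by (simp add: positive_at_Suc positive_at_0)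
    then have "X \<in> H_ideal A (ord_of_nat 1)" by (simp only: H_ideal_ord_of_nat_iff not_False_eq_True)
    then show ?thesis using X by blast
  qed
  then show ?thesis
    using H_ideal_subset_H_below_omega[of 1] unfolding tall_def by blast
qed

section \<open>The Borel class and the separation rank\<close>

text \<open>Failing to be positive says \<open>\<exists>m. \<forall>k\<ge>m\<close> of the failure one level further down, so each level of
  the tree costs two steps in the Borel hierarchy.\<close>

lemma Sigma0_not_positive_at:
  "Sigma0 (powerset_topology UNIV) (ord_of_nat (2 * n + 2)) {X. \<not> positive_at A n X s}"
proof (induction n arbitrary: s)
  case 0
  have "openin (powerset_topology UNIV) (\<Union>q\<in>A s \<inter> {m..}. {X. q \<in> X})" for m
    using openin_powerset_topology_member by (intro openin_Union) auto
  then have "Sigma0 (powerset_topology UNIV) (ord_of_nat (Suc 0)) (- {X. X \<inter> A s \<inter> {m..} = {}})" for m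
    unfolding ord_of_nat_1
    by (rule Sigma0_open[OF back_subst[of "openin _"]]) auto
  then have "Sigma0 (powerset_topology UNIV) (ord_of_nat (Suc (Suc 0)))
      (\<Union>m. {X. X \<inter> A s \<inter> {m..} = {}})"
    by (rule Sigma0_UNION_Suc)
  moreover have "(\<Union>m. {X. X \<inter> A s \<inter> {m..} = {}}) = {X. \<not> positive_at A 0 X s}"
    by (auto simp: positive_at_0 infinite_nat_iff_unbounded_le)
  ultimately show ?case by (simp add: numeral_2_eq_2)
next
  case (Suc n)
  have "Sigma0 (powerset_topology UNIV) (ord_of_nat (Suc (2 * n + 2)))
      (\<Union>j. {X. positive_at A n X (s @ [m + j])})" for m
  proof -
    have "Sigma0 (powerset_topology UNIV) (ord_of_nat (Suc (2 * n + 1)))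
        (- {X. positive_at A n X (s @ [m + j])})" for j
      using Suc.IH[of "s @ [m + j]"] by (simp add: Collect_neg_eq)
    from Sigma0_UNION_Suc[OF this] show ?thesis by simp
  qed
  then have "Sigma0 (powerset_topology UNIV) (ord_of_nat (Suc (2 * n + 2)))
      (- {X. \<forall>k\<ge>m. \<not> positive_at A n X (s @ [k])})" for m
    by (rule back_subst[of "Sigma0 _ _"]) (auto simp: le_iff_add)
  then have "Sigma0 (powerset_topology UNIV) (ord_of_nat (Suc (Suc (2 * n + 2))))
      (\<Union>m. {X. \<forall>k\<ge>m. \<not> positive_at A n X (s @ [k])})"
    by (rule Sigma0_UNION_Suc)
  moreover have "(\<Union>m. {X. \<forall>k\<ge>m. \<not> positive_at A n X (s @ [k])}) = {X. \<not> positive_at A (Suc n) X s}"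
    by (auto simp: positive_at_Suc infinite_nat_iff_unbounded_le)
  ultimately show ?case by simp
qed

lemma Sigma0_H_ideal:
  "Sigma0 (powerset_topology UNIV) (ord_of_nat (2 * n + 2)) (H_ideal A (ord_of_nat n))"
proof -
  have "H_ideal A (ord_of_nat n) = {X. \<not> positive_at A n X []}"
    by (auto simp: H_ideal_ord_of_nat_iff)
  then show ?thesis using Sigma0_not_positive_at[of n "[]"] by simp
qed

lemma Sigma0_H_below_omega: "Sigma0 (powerset_topology UNIV) omega (H_below_omega A)"
  unfolding H_below_omega_def
proof (rule Sigma0_Union)
  show "1 < omega" using ord_of_nat_less_omega[of "Suc 0"] by (simp add: ord_of_nat_1)
  fix n
  let ?k = "Suc (Suc (Suc (2 * n)))"
  have "Sigma0 (powerset_topology UNIV) (ord_of_nat ?k) (\<Union>i :: nat. - H_ideal A (ord_of_nat n))"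
    by (rule Sigma0_UNION_Suc) (use Sigma0_H_ideal[of n] in simp)
  then show "H_ideal A (ord_of_nat n) \<subseteq> topspace (powerset_topology UNIV) \<and>
      (\<exists>\<eta>\<ge>1. \<eta> < omega \<and> Sigma0 (powerset_topology UNIV) \<eta>
        (topspace (powerset_topology UNIV) - H_ideal A (ord_of_nat n)))"
    using ord_of_nat_less_omega[of ?k] one_le_ord_of_nat_Suc
    by (auto simp: topspace_powerset_topology Compl_eq_Diff_UNIV)
qed

text \<open>The diagonal construction behind the lower bound for the rank and behind strictness in the Katetov
  order. The set \<open>X\<close> makes itself almost everything if it lies in \<open>S\<close>, and almost nothing otherwise,
  by letting each point \<open>q\<close> follow the prediction about \<open>X \<in> S\<close> attached to its cell of length \<open>m\<close>.
  At the time when \<open>q\<close> is decided only \<open>X \<inter> {..<q}\<close> is known. This suffices unless the prediction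
  inspects a point \<open>\<ge> q\<close>, which happens for only finitely many \<open>q\<close> in each cell of length \<open>m\<close>.\<close>

lemma iterated_limit_does_not_separate:
  assumes S: "iterated_limit m S"
  obtains X where "X \<in> S" "- X \<in> H_ideal A (ord_of_nat m)"
  | X where "X \<notin> S" "X \<in> H_ideal A (ord_of_nat m)"
proof -
  obtain f where fd: "\<And>t. finitely_determined (f t)"
    and f: "\<And>X. {t. length t = m \<and> f t X \<noteq> (X \<in> S)} \<in> Fin_pow m"
    using S unfolding iterated_limit_def by blast
  obtain N where N: "\<And>t X Y. X \<inter> {..<N t} = Y \<inter> {..<N t} \<Longrightarrow> f t X = f t Y"
    using fd unfolding finitely_determined_def by metis
  obtain addr where addr: "\<And>q. length (addr q) = m" "\<And>q. q \<in> A (addr q)"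
    using ex_cell[of m] by metis
  obtain p where p: "\<And>q. p q \<longleftrightarrow> f (addr q) {i. i < q \<and> p i}"
  proof -
    have "\<exists>p. \<forall>q. p q = f (addr q) {i. i < q \<and> p i}"
      by (rule dependent_wellorder_choice) (auto intro!: arg_cong[where f = "f _"])
    then show ?thesis using that by blast
  qed
  define X where "X = {q. p q}"
  have X_iff: "q \<in> X \<longleftrightarrow> f (addr q) X" if "N (addr q) \<le> q" for q
  proof -
    have "f (addr q) {i. i < q \<and> p i} = f (addr q) X"
      using that by (intro N) (auto simp: X_def)
    then show ?thesis using p[of q] by (simp add: X_def)
  qed
  \<comment> \<open>The points decided too early, and the indices of the wrong predictions.\<close>
  define E where "E = {q. q < N (addr q)}"
  define B where "B = {t. length t = m \<and> f t X \<noteq> (X \<in> S)}"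
  have "\<not> positive_at A m (E \<union> (\<Union>t\<in>B. A t)) []"
  proof
    assume "positive_at A m (E \<union> (\<Union>t\<in>B. A t)) []"
    then have "positive_at A m E []"
      using not_positive_at_Fin_pow[of B m "[]"] f[of X] by (auto simp: positive_at_Un B_def)
    then obtain t where t: "length t = m" "infinite (E \<inter> A t)"
      using positive_at_imp_infinite_cell[of m E "[]"] by auto
    have "addr q = t" if "q \<in> A t" for q
      using that addr t(1) by (metis cell_unique)
    then have "E \<inter> A t \<subseteq> {..<N t}" by (auto simp: E_def)
    then show False using t(2) finite_subset by blast
  qed
  then have null: "E \<union> (\<Union>t\<in>B. A t) \<in> H_ideal A (ord_of_nat m)"
    by (simp add: H_ideal_ord_of_nat_iff)
  have "q \<in> E \<union> (\<Union>t\<in>B. A t)" if "(q \<in> X) \<noteq> (X \<in> S)" for q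
    using that X_iff[of q] addr[of q] by (auto simp: E_def B_def not_less)
  then have *: "C \<in> H_ideal A (ord_of_nat m)" if "\<And>q. q \<in> C \<Longrightarrow> (q \<in> X) \<noteq> (X \<in> S)" for C
    using that by (intro ideal_on_subset[OF ideal_on_H_ideal null] subsetI) blast
  show ?thesis
  proof (cases "X \<in> S")
    case True
    then have "- X \<in> H_ideal A (ord_of_nat m)" by (intro *) simp
    with True show ?thesis by (rule that(1))
  next
    case False
    then have "X \<in> H_ideal A (ord_of_nat m)" by (intro *) simp
    with False show ?thesis by (rule that(2))
  qed
qed

text \<open>Separation at a finite rank \<open>n\<close> involves the class \<open>\<Sigma>\<^sup>0\<^bsub>n + 1\<^esub>\<close>, hence \<open>n + 1\<close> limits.\<close>

lemma has_separation_rank_H_below_omega: "has_separation_rank (H_below_omega A) omega"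
  unfolding has_separation_rank_def
proof (intro conjI allI impI notI)
  have "H_below_omega A \<inter> dual_filter (H_below_omega A) = {}"
    using ideal_on_Compl[OF ideal_on_H_below_omega]
    by (auto simp: dual_filter_def dom_H_below_omega Compl_eq_Diff_UNIV)
  then show "Sigma0_separated (H_below_omega A) omega"
    using Sigma0_H_below_omega unfolding Sigma0_separated_def dom_H_below_omega one_oplus_def by auto
next
  fix \<beta> assume "\<beta> < omega" and sep: "Sigma0_separated (H_below_omega A) \<beta>"
  then obtain n where n: "\<beta> = ord_of_nat n" by (auto simp: less_omega_iff)
  then have "one_oplus \<beta> = ord_of_nat (Suc n)"
    by (simp add: one_oplus_def ord_of_nat_less_omega ord_of_nat_Suc)
  then obtain S where S: "Sigma0 (powerset_topology UNIV) (ord_of_nat (Suc n)) S"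
      "H_below_omega A \<subseteq> S" "S \<inter> dual_filter (H_below_omega A) = {}"
    using sep unfolding Sigma0_separated_def dom_H_below_omega by auto
  have "iterated_limit (Suc n) S" using S(1) by (rule Sigma0_imp_iterated_limit) simp
  then show False
  proof (cases rule: iterated_limit_does_not_separate)
    case (1 X)
    have "- X \<in> H_below_omega A" using 1(2) H_ideal_subset_H_below_omega by blast
    moreover have "X = UNIV - (- X)" by blast
    ultimately have "X \<in> dual_filter (H_below_omega A)"
      unfolding dual_filter_def dom_H_below_omega by blast
    then show False using 1(1) S(3) by blast
  next
    case (2 X)
    then show False using S(2) H_ideal_subset_H_below_omega by blast
  qed
qed

section \<open>Katetov comparisons\<close>

text \<open>Separating sets pull back along Katetov reductions, and taking preimages under \<open>h\<close> preserves
  iterated limits; so the separation of \<open>\<H>\<^sub>n\<close> by itself would transfer to \<open>\<H>\<^bsub><\<omega>\<^esub>\<close>.\<close>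

lemma H_below_omega_not_Katetov_le: "\<not> H_below_omega A \<le>\<^sub>K H_ideal A (ord_of_nat n)"
proof
  assume "H_below_omega A \<le>\<^sub>K H_ideal A (ord_of_nat n)"
  then obtain h where h: "\<And>B. B \<in> H_below_omega A \<Longrightarrow> h -` B \<in> H_ideal A (ord_of_nat n)"
    unfolding Katetov_le_def dom_H_ideal by auto
  have "iterated_limit (2 * n + 2) {X. h -` X \<in> H_ideal A (ord_of_nat n)}"
    by (intro iterated_limit_vimage Sigma0_imp_iterated_limit[OF Sigma0_H_ideal]) simp
  then show False
  proof (cases rule: iterated_limit_does_not_separate)
    case (1 X)
    have "- X \<in> H_below_omega A" using 1(2) H_ideal_subset_H_below_omega by blast
    then have "- (h -` X) \<in> H_ideal A (ord_of_nat n)" using h[of "- X"] by (simp add: vimage_Compl)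
    moreover have "h -` X \<in> H_ideal A (ord_of_nat n)" using 1(1) by simp
    ultimately show False using ideal_on_Compl[OF ideal_on_H_ideal] by blast
  next
    case (2 X)
    then have "h -` X \<in> H_ideal A (ord_of_nat n)" using h H_ideal_subset_H_below_omega by blast
    then show False using 2(1) by simp
  qed
qed

end

text \<open>Reductions \<open>g r\<close> of all \<open>Fin\<^bsup>\<otimes>r\<^esup>\<close> combine to one bijection \<open>f\<close>, defined by recursion. Outside \<open>Z\<close>,
  the value \<open>f y\<close> imitates \<open>g 1 y, \<dots>, g y y\<close>; independence provides infinitely many candidates, so one
  of them is fresh. Each \<open>g r\<close> is thereby respected at all but finitely many points outside \<open>Z\<close>. On
  \<open>Z\<close>, where the ideal is indifferent to the values, \<open>f\<close> takes the least number not yet used; as \<open>Z\<close>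
  is infinite, no number is left out.\<close>

lemma Fin'_omega_iso_below:
  fixes J :: "nat set set" and g :: "nat \<Rightarrow> nat \<Rightarrow> nat list"
  assumes P: "independent_partitions P" and J: "ideal_on UNIV J" and Z: "Z \<in> J" "infinite Z"
    and len: "\<And>r y. r \<ge> 1 \<Longrightarrow> length (g r y) = r"
    and g: "\<And>r B. r \<ge> 1 \<Longrightarrow> B \<in> Fin_pow r \<Longrightarrow> g r -` B \<in> J"
  shows "Fin'_omega P \<sqsubseteq> J"
proof -
  define R where "R f y x \<longleftrightarrow> x \<notin> f ` {..<y} \<and>
      (if y \<in> Z then {..<x} \<subseteq> f ` {..<y} else \<forall>r\<in>{1..y}. P r x = g r y)"
    for f :: "nat \<Rightarrow> nat" and y x :: nat
  have "\<exists>f. \<forall>y. R f y (f y)"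
  proof (rule dependent_wellorder_choice)
    fix r y and f h :: "nat \<Rightarrow> nat"
    assume "\<And>i. i < y \<Longrightarrow> f i = h i"
    then have "f ` {..<y} = h ` {..<y}" by auto
    then show "R f y r = R h y r" by (simp add: R_def)
  next
    fix y and f :: "nat \<Rightarrow> nat"
    show "\<exists>x. R f y x"
    proof (cases "y \<in> Z")
      case True
      have "\<exists>x. x \<notin> f ` {..<y}" by (rule ex_new_if_finite) auto
      then have "(LEAST x. x \<notin> f ` {..<y}) \<notin> f ` {..<y}" by (rule LeastI_ex)
      moreover have "{..<(LEAST x. x \<notin> f ` {..<y})} \<subseteq> f ` {..<y}"
        by (auto dest: not_less_Least)
      ultimately show ?thesis unfolding R_def using True by (simp only: if_True) blast
    next
      case False
      have "infinite (\<Inter>r\<in>{1..y}. P r -` {g r y})"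
        using P len unfolding independent_partitions_def by auto
      then have "infinite ((\<Inter>r\<in>{1..y}. P r -` {g r y}) - f ` {..<y})" by simp
      then obtain x where "x \<in> (\<Inter>r\<in>{1..y}. P r -` {g r y}) - f ` {..<y}"
        by (metis ex_in_conv finite.emptyI)
      then show ?thesis using False by (intro exI[of _ x]) (auto simp: R_def)
    qed
  qed
  then obtain f where f: "\<And>y. R f y (f y)" by blast
  have fresh: "f y \<notin> f ` {..<y}" for y using f unfolding R_def by blast
  have "f x \<noteq> f y" if "x < y" for x y using fresh[of y] that by (metis imageI lessThan_iff)
  then have inj: "inj f" by (metis injI linorder_neq_iff)
  have "x \<in> range f" for x
  proof (rule ccontr)
    assume x: "x \<notin> range f"
    have "f ` Z \<subseteq> {..<x}"
    proof safe
      fix y assume "y \<in> Z"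
      then have "\<not> x < f y" "x \<noteq> f y" using f[of y] x by (auto simp: R_def)
      then show "f y < x" by simp
    qed
    then have "finite (f ` Z)" by (rule finite_subset) simp
    then show False using Z(2) inj by (simp add: finite_image_iff inj_on_subset)
  qed
  then have bij: "bij f" using inj by (auto simp: bij_def)
  note un = ideal_on_Un[OF J] and fin = ideal_on_finite[OF J]
  have "f -` C \<in> J" if gen: "C \<in> Fin'_omega P" for C
  proof -
    obtain n B where B: "\<forall>r\<in>{1..n}. B r \<in> Fin_pow r" and C: "C \<subseteq> (\<Union>r\<in>{1..n}. P r -` B r)"
      using gen unfolding Fin'_omega_def by blast
    have "(\<Union>r\<in>Q. g r -` B r) \<in> J" if "finite Q" "Q \<subseteq> {1..n}" for Q
      using that
    proof (induction Q)
      case (insert r Q)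
      then have "g r -` B r \<in> J" using g[of r "B r"] B by simp
      then show ?case using insert un by simp
    qed (simp add: fin)
    then have "(\<Union>r\<in>{1..n}. g r -` B r) \<union> Z \<union> {..<n} \<in> J" by (simp add: un fin Z(1))
    moreover have "f -` C \<subseteq> (\<Union>r\<in>{1..n}. g r -` B r) \<union> Z \<union> {..<n}"
    proof
      fix y assume "y \<in> f -` C"
      then obtain r where r: "r \<in> {1..n}" "P r (f y) \<in> B r" using C by blast
      show "y \<in> (\<Union>r\<in>{1..n}. g r -` B r) \<union> Z \<union> {..<n}"
      proof (cases "y \<in> Z \<or> y < n")
        case False
        then have "P r (f y) = g r y" using f[of y] r(1) by (auto simp: R_def)
        then show ?thesis using r by auto
      qed auto
    qed
    ultimately show ?thesis by (rule ideal_on_subset[OF J])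
  qed
  then show ?thesis
    unfolding iso_below_def ideal_on_dom[OF J] dom_Fin'_omega[OF P] using bij by auto
qed

lemma Fin'_omega_iso_below_H_below_omega:
  assumes A: "tree_partition A" and P: "independent_partitions P"
  shows "Fin'_omega P \<sqsubseteq> H_below_omega A"
proof -
  note J = ideal_on_H_below_omega[OF A]
  obtain Z where Z: "Z \<in> H_below_omega A" "infinite Z"
    using tall_H_below_omega[OF A] unfolding tall_def dom_H_below_omega[OF A] by auto
  obtain addr where addr: "\<And>r q. length (addr r q) = r" "\<And>r q. q \<in> A (addr r q)"
    using ex_cell[OF A] by metis
  show ?thesis
  proof (rule Fin'_omega_iso_below[OF P J Z, of addr])
    fix r B assume B: "B \<in> Fin_pow r"
    have "(\<Union>t\<in>B. A t) \<in> H_below_omega A"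
      using not_positive_at_Fin_pow[OF A B, of "[]"] H_ideal_subset_H_below_omega[OF A, of r]
      by (auto simp: H_ideal_ord_of_nat_iff)
    moreover have "addr r -` B \<subseteq> (\<Union>t\<in>B. A t)" using addr(2) by blast
    ultimately show "addr r -` B \<in> H_below_omega A" by (rule ideal_on_subset[OF J])
  qed (rule addr(1))
qed

theorem proposition3p8:
  fixes A :: "nat list \<Rightarrow> nat set"
  assumes "tree_partition A"
  shows "H_below_omega A = H_ideal A omega \<and>
    ideal_on UNIV (H_below_omega A) \<and>
    tall (H_below_omega A) \<and>
    Sigma0 (powerset_topology UNIV) omega (H_below_omega A) \<and>
    has_separation_rank (H_below_omega A) omega \<and>
    (\<forall>n. H_ideal A (ord_of_nat n) \<le>\<^sub>K\<^sub>B H_below_omega A \<and>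
         H_ideal A (ord_of_nat n) \<le>\<^sub>K H_below_omega A \<and>
         \<not> H_below_omega A \<le>\<^sub>K H_ideal A (ord_of_nat n) \<and>
         \<not> H_below_omega A \<le>\<^sub>K\<^sub>B H_ideal A (ord_of_nat n)) \<and>
    (\<forall>P. independent_partitions P \<longrightarrow> Fin'_omega P \<sqsubseteq> H_below_omega A)"
proof -
  note A = assms
  have KB: "H_ideal A (ord_of_nat n) \<le>\<^sub>K\<^sub>B H_below_omega A" for n
    unfolding Katetov_Blass_le_def dom_H_ideal[OF A] dom_H_below_omega[OF A]
    using H_ideal_subset_H_below_omega[OF A, of n] by (intro bexI[of _ "\<lambda>x. x"]) (auto simp: vimage_def)
  note nK = H_below_omega_not_Katetov_le[OF A]
  have nKB: "\<not> H_below_omega A \<le>\<^sub>K\<^sub>B H_ideal A (ord_of_nat n)" for n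
    using nK Katetov_Blass_le_imp_Katetov_le by (rule contrapos_nn)
  show ?thesis
    by (intro conjI allI impI H_below_omega_eq ideal_on_H_below_omega[OF A] tall_H_below_omega[OF A]
        Sigma0_H_below_omega[OF A] has_separation_rank_H_below_omega[OF A] KB Katetov_Blass_le_imp_Katetov_le[OF KB] nK nKB
        Fin'_omega_iso_below_H_below_omega[OF A])
qed

end
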